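(* Let $\mu$ and $\mu_m$ ($m\in\mathbb{N}$) be measures all with the same compact support $\Gamma$ and with densities $\rho(x)$ and $\rho_m(x)$ respectively. Suppose that $\rho_m$ converges in $L^1(\Gamma)$ to $\rho$ as $m\to\infty$. Let $\zeta\in\mathbb{C}$, let $z_0$ be a solution of $G_\mu(z)=\zeta$, and let $d>0$ be such that $z_0$ is the only root of $G_\mu(z)=\zeta$ in the open disc $B_{d,z_0}\subset\mathbb{C}\setminus\Gamma$ and has order $k$. Then for any $\varepsilon\in(0,d)$, the number of zeros (counted with multiplicity) of $G_{\mu,m}-\zeta$ inside $B_{\varepsilon,z_0}$ is $k$ if $$\frac{1}{\operatorname{dist}(z_0,\Gamma)-\varepsilon}\,\|\rho_m-\rho\|_{L^1(\Gamma)}<\frac{|G_\mu^{(k)}(z_0)|}{k!}\,\varepsilon^k-M_{d,z_0}\,\frac{b^{k+1}}{1-b},$$ where $b=\frac{\varepsilon}{d}<1$ and $M_{d,z_0}=\max_{|w-z_0|=d}|G_\mu(w)-\zeta|$. In particular, for fixed $z_0$, the distance of the roots of $G_{\mu,m}-\zeta$ to $z_0$ is $O\bigl(\|\rho_m-\rho\|_{L^1(\Gamma)}^{1/k}\bigr)$.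
   Context: $\Gamma\subset\mathbb{R}$. The Stieltjes transforms of $\mu$ and $\mu_m$ are $G_\mu(z)=\int_\Gamma\frac{\rho(x)}{z-x}\,\mathrm{d}x$ and $G_{\mu,m}(z)=\int_\Gamma\frac{\rho_m(x)}{z-x}\,\mathrm{d}x$ for $z\in\mathbb{C}\setminus\Gamma$. $B_{r,z_0}$ is the open disc centred at $z_0$ with radius $r$, and $\operatorname{dist}(z_0,\Gamma)=\inf_{x\in\Gamma}|z_0-x|$. *)

theory Defs
  imports "HOL-Complex_Analysis.Complex_Analysis"
begin

definition measure_support :: "'a::topological_space measure \<Rightarrow> 'a set" where
  "measure_support \<mu> = {x. \<forall>U. open U \<and> x \<in> U \<longrightarrow> emeasure \<mu> U > 0}"

text \<open>The density is a function on \<open>\<Gamma>\<close> only: its values off \<open>\<Gamma>\<close> are irrelevant.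
  It is required to lie in \<open>L\<^sup>1(\<Gamma>)\<close>, and to be nonnegative because \<^const>\<open>ennreal\<close>
  truncates negative values to \<open>0\<close>.\<close>

definition has_density_on :: "real measure \<Rightarrow> real set \<Rightarrow> (real \<Rightarrow> real) \<Rightarrow> bool" where
  "has_density_on \<mu> \<Gamma> \<rho> \<longleftrightarrow>
     set_integrable lborel \<Gamma> \<rho> \<and>
     (AE x\<in>\<Gamma> in lborel. 0 \<le> \<rho> x) \<and>
     \<mu> = density lborel (\<lambda>x. ennreal (indicator \<Gamma> x * \<rho> x))"

text \<open>Only meaningful for \<open>z\<close> outside \<open>\<Gamma>\<close>.\<close>

definition stieltjes :: "real set \<Rightarrow> (real \<Rightarrow> real) \<Rightarrow> complex \<Rightarrow> complex" where
  "stieltjes \<Gamma> \<rho> z = (LINT x:\<Gamma>|lborel. complex_of_real (\<rho> x) / (z - complex_of_real x))"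

definition L1_norm_on :: "real set \<Rightarrow> (real \<Rightarrow> real) \<Rightarrow> real" where
  "L1_norm_on \<Gamma> f = (LINT x:\<Gamma>|lborel. \<bar>f x\<bar>)"

text \<open>Finiteness is part of the definition, since a sum over an infinite set is \<open>0\<close>.\<close>

definition has_zero_count :: "(complex \<Rightarrow> complex) \<Rightarrow> complex set \<Rightarrow> nat \<Rightarrow> bool" where
  "has_zero_count f S n \<longleftrightarrow>
     finite {z \<in> S. f z = 0} \<and> (\<Sum>z\<in>{z \<in> S. f z = 0}. zorder f z) = int n"

text \<open>The open disc of radius \<open>d\<close> avoids \<open>\<Gamma>\<close>, but the circle bounding it may meet \<open>\<Gamma>\<close>, where
  the Stieltjes transform is undefined. The maximum over the circle is therefore taken over its
  points outside \<open>\<Gamma>\<close>; it exists whenever the circle is disjoint from \<open>\<Gamma>\<close>, but possibly not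
  otherwise, hence a relation instead of a function.\<close>

definition is_circle_max ::
    "real set \<Rightarrow> (complex \<Rightarrow> complex) \<Rightarrow> complex \<Rightarrow> real \<Rightarrow> real \<Rightarrow> bool" where
  "is_circle_max \<Gamma> f z0 d M \<longleftrightarrow>
     (\<exists>w \<in> sphere z0 d - complex_of_real ` \<Gamma>. cmod (f w) = M) \<and>
     (\<forall>w \<in> sphere z0 d - complex_of_real ` \<Gamma>. cmod (f w) \<le> M)"

end

theory Submission
  imports Defs
begin

text \<open>
  Write \<open>f = G\<^sub>\<mu> - \<zeta>\<close> and let \<open>F = G\<^sub>\<mu>\<^sub>,\<^sub>m - \<zeta>\<close> be its perturbation. Both are holomorphic off \<open>\<Gamma>\<close>, and
  on the closed disc of radius \<open>\<epsilon>\<close> about \<open>z\<^sub>0\<close> every point of \<open>\<Gamma>\<close> is at distance at least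
  \<open>dist(z\<^sub>0, \<Gamma>) - \<epsilon>\<close>, so there \<open>F - f\<close> is bounded by the \<open>L\<^sup>1\<close> distance of the densities divided by that
  number. In the Taylor expansion of \<open>f\<close> at \<open>z\<^sub>0\<close> the coefficients below the order \<open>k\<close> vanish
  (\<open>higher_deriv_eq_0_below_zorder\<close>) and the terms above \<open>k\<close> add up to at most
  \<open>M b\<^sup>k\<^sup>+\<^sup>1 / (1 - b)\<close> (\<open>Taylor_remainder_le\<close>). The assumed inequality therefore says that
  \<open>F - f\<close> is smaller than \<open>f\<close> on the circle of radius \<open>\<epsilon>\<close>, and the theorem of Rouche moves the zero
  count \<open>k\<close> from \<open>f\<close> to \<open>F\<close> (\<open>has_zero_count_perturbation\<close>).

  The delicate point is the bound \<open>\<bar>f\<bar> \<le> M\<close> inside the disc, on which the coefficient estimates rest.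
  The circle of radius \<open>d\<close> may touch \<open>\<Gamma>\<close>, \<open>f\<close> may be unbounded there, and \<open>M\<close> only
  controls \<open>f\<close> on the rest of the circle. But the circle meets the real line in at most two points,
  and \<open>f\<close> grows at most like the inverse square of the distance to them
  (\<open>dist_real_outside_disc_bound\<close>), whereas a violation of the maximum principle caused by an isolated
  boundary point would require exponential growth. A Phragmen--Lindelof argument
  (\<open>phragmen_lindelof_disc\<close>) makes this precise and gives \<open>stieltjes_le_circle_max\<close>.

  For the asymptotic statement, \<open>\<bar>f w\<bar> \<ge> c \<bar>w - z\<^sub>0\<bar>\<^sup>k\<close> near \<open>z\<^sub>0\<close> (\<open>zorder_lower_bound\<close>), while
  at a root \<open>w\<close> of \<open>F\<close> one has \<open>\<bar>f w\<bar> = \<bar>f w - F w\<bar>\<close>, which is bounded by a multiple of the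
  \<open>L\<^sup>1\<close> distance; taking \<open>k\<close>-th roots gives the rate. Away from \<open>z\<^sub>0\<close>, \<open>\<bar>f\<bar>\<close> is bounded
  below on compact subsets of the disc, so \<open>F\<close> eventually has no roots there.
\<close>

section \<open>Stieltjes transforms of integrable densities\<close>

text \<open>The common source of all estimates of Stieltjes integrals below: the kernel \<open>1 / (z - x)\<close>, its square
  and its difference quotients are bounded on \<open>\<Gamma>\<close> once \<open>z\<close> keeps a positive distance from \<open>\<Gamma>\<close>.\<close>

lemma
  fixes \<rho> :: "real \<Rightarrow> real" and K :: "real \<Rightarrow> complex"
  assumes \<rho>: "set_integrable lborel \<Gamma> \<rho>" and K: "K \<in> borel_measurable borel"
    and B: "\<And>x. x \<in> \<Gamma> \<Longrightarrow> cmod (K x) \<le> B"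
  shows set_integrable_mult_bounded_kernel:
      "set_integrable lborel \<Gamma> (\<lambda>x. complex_of_real (\<rho> x) * K x)"
    and norm_integral_mult_bounded_kernel_le:
      "cmod (LINT x:\<Gamma>|lborel. complex_of_real (\<rho> x) * K x) \<le> B * L1_norm_on \<Gamma> \<rho>"
proof -
  let ?r = "\<lambda>x. indicator \<Gamma> x *\<^sub>R \<rho> x"
  have r: "integrable lborel ?r"
    using \<rho> by (simp add: set_integrable_def)
  have eq: "(\<lambda>x. indicator \<Gamma> x *\<^sub>R (complex_of_real (\<rho> x) * K x))
      = (\<lambda>x. complex_of_real (?r x) * K x)"
    by (auto simp: indicator_def)
  have meas: "(\<lambda>x. complex_of_real (?r x) * K x) \<in> borel_measurable lborel"
    using borel_measurable_integrable[OF r] K by measurable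
  have le: "cmod (complex_of_real (?r x) * K x) \<le> B * norm (?r x)" for x
    using B[of x] mult_right_mono[OF B[of x], of "\<bar>\<rho> x\<bar>"]
    by (cases "x \<in> \<Gamma>") (auto simp: norm_mult mult.commute)
  have "integrable lborel (\<lambda>x. B * norm (?r x))"
    using r by simp
  then have int: "integrable lborel (\<lambda>x. complex_of_real (?r x) * K x)"
  proof (rule Bochner_Integration.integrable_bound[OF _ meas])
    show "AE x in lborel. cmod (complex_of_real (?r x) * K x) \<le> norm (B * norm (?r x))"
      using order_trans[OF le abs_ge_self] by (intro AE_I2) simp
  qed
  then show "set_integrable lborel \<Gamma> (\<lambda>x. complex_of_real (\<rho> x) * K x)"
    unfolding set_integrable_def eq .
  have "cmod (LINT x|lborel. complex_of_real (?r x) * K x)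
      \<le> (LINT x|lborel. cmod (complex_of_real (?r x) * K x))"
    by (rule integral_norm_bound)
  also have "\<dots> \<le> (LINT x|lborel. B * norm (?r x))"
    using int r le by (intro integral_mono) auto
  also have "\<dots> = B * L1_norm_on \<Gamma> \<rho>"
    unfolding L1_norm_on_def set_lebesgue_integral_def
    by (simp add: abs_mult)
  finally show "cmod (LINT x:\<Gamma>|lborel. complex_of_real (\<rho> x) * K x) \<le> B * L1_norm_on \<Gamma> \<rho>"
    unfolding set_lebesgue_integral_def eq .
qed

lemma borel_measurable_cauchy_kernel [measurable]:
  "(\<lambda>x. 1 / (z - complex_of_real x)) \<in> borel_measurable borel"
  by measurable

lemma
  fixes \<rho> :: "real \<Rightarrow> real"
  assumes \<rho>: "set_integrable lborel \<Gamma> \<rho>" and "0 < \<delta>"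
    and away: "\<And>x. x \<in> \<Gamma> \<Longrightarrow> \<delta> \<le> cmod (z - complex_of_real x)"
  shows set_integrable_stieltjes:
      "set_integrable lborel \<Gamma> (\<lambda>x. complex_of_real (\<rho> x) / (z - complex_of_real x))"
    and norm_stieltjes_le: "cmod (stieltjes \<Gamma> \<rho> z) \<le> 1 / \<delta> * L1_norm_on \<Gamma> \<rho>"
proof -
  have "cmod (1 / (z - complex_of_real x)) \<le> 1 / \<delta>" if "x \<in> \<Gamma>" for x
    using away[OF that] \<open>0 < \<delta>\<close> by (simp add: norm_divide frac_le)
  note * = set_integrable_mult_bounded_kernel[OF \<rho> borel_measurable_cauchy_kernel this]
    norm_integral_mult_bounded_kernel_le[OF \<rho> borel_measurable_cauchy_kernel this]
  show "set_integrable lborel \<Gamma> (\<lambda>x. complex_of_real (\<rho> x) / (z - complex_of_real x))"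
    using *(1) by simp
  show "cmod (stieltjes \<Gamma> \<rho> z) \<le> 1 / \<delta> * L1_norm_on \<Gamma> \<rho>"
    using *(2) by (simp add: stieltjes_def)
qed

lemma norm_stieltjes_diff_le:
  fixes \<rho> \<rho>' :: "real \<Rightarrow> real"
  assumes \<rho>: "set_integrable lborel \<Gamma> \<rho>" and \<rho>': "set_integrable lborel \<Gamma> \<rho>'" and \<delta>: "0 < \<delta>"
    and away: "\<And>x. x \<in> \<Gamma> \<Longrightarrow> \<delta> \<le> cmod (z - complex_of_real x)"
  shows "cmod (stieltjes \<Gamma> \<rho>' z - stieltjes \<Gamma> \<rho> z) \<le> 1 / \<delta> * L1_norm_on \<Gamma> (\<lambda>x. \<rho>' x - \<rho> x)"
proof -
  have "stieltjes \<Gamma> \<rho>' z - stieltjes \<Gamma> \<rho> z = stieltjes \<Gamma> (\<lambda>x. \<rho>' x - \<rho> x) z"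
    unfolding stieltjes_def
    using set_integral_diff(2)[OF set_integrable_stieltjes[OF \<rho>' \<delta> away]
        set_integrable_stieltjes[OF \<rho> \<delta> away]]
    by (simp add: diff_divide_distrib)
  then show ?thesis
    using norm_stieltjes_le[OF set_integral_diff(1)[OF \<rho>' \<rho>] \<delta> away] by simp
qed

lemma separated_from_compact_support:
  assumes "compact \<Gamma>" "z \<notin> complex_of_real ` \<Gamma>"
  obtains \<delta> where "0 < \<delta>" "\<And>x. x \<in> \<Gamma> \<Longrightarrow> \<delta> \<le> cmod (z - complex_of_real x)"
proof -
  have "closed (complex_of_real ` \<Gamma>)"
    using assms(1) by (intro compact_imp_closed compact_continuous_image continuous_intros) auto
  from separate_point_closed[OF this assms(2)] obtain \<delta> where
    "\<delta> > 0" "\<forall>y\<in>complex_of_real ` \<Gamma>. \<delta> \<le> dist z y" by blast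
  then show ?thesis
    by (intro that[of \<delta>]) (auto simp: dist_norm)
qed

text \<open>The difference quotient minus the candidate derivative is again an integral of \<open>\<rho>\<close> against a
  kernel, namely \<open>(w - z) / ((z - x)\<^sup>2 (w - x))\<close>, which is \<open>O(\<bar>w - z\<bar>)\<close> uniformly in \<open>x\<close>.\<close>

lemma stieltjes_has_field_derivative:
  assumes \<rho>: "set_integrable lborel \<Gamma> \<rho>" and "compact \<Gamma>" "z \<notin> complex_of_real ` \<Gamma>"
  shows "(stieltjes \<Gamma> \<rho> has_field_derivative
      (LINT x:\<Gamma>|lborel. complex_of_real (\<rho> x) * (- 1 / (z - complex_of_real x)\<^sup>2))) (at z)"
    (is "(_ has_field_derivative ?D) _")
proof -
  obtain \<delta> where \<delta>: "0 < \<delta>" and away: "\<And>x. x \<in> \<Gamma> \<Longrightarrow> \<delta> \<le> cmod (z - complex_of_real x)"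
    using separated_from_compact_support[OF assms(2,3)] by blast
  let ?N = "L1_norm_on \<Gamma> \<rho>"
  have bound: "cmod ((stieltjes \<Gamma> \<rho> w - stieltjes \<Gamma> \<rho> z) / (w - z) - ?D)
      \<le> cmod (w - z) * 2 / \<delta> ^ 3 * ?N" if w: "w \<noteq> z" "cmod (w - z) < \<delta> / 2" for w
  proof -
    have away_w: "\<delta> / 2 \<le> cmod (w - complex_of_real x)" if "x \<in> \<Gamma>" for x
      using away[OF that] w(2) norm_triangle_ineq4[of "w - complex_of_real x" "w - z"] by simp
    have \<delta>2: "0 < \<delta> / 2" using \<delta> by simp
    have kz: "cmod (- 1 / (z - complex_of_real x)\<^sup>2) \<le> 1 / \<delta>\<^sup>2" if "x \<in> \<Gamma>" for x
      using away[OF that] \<delta> by (simp add: norm_divide norm_power frac_le power_mono)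
    have m: "(\<lambda>x. - 1 / (z - complex_of_real x)\<^sup>2) \<in> borel_measurable borel"
      by measurable
    define k where "k = (\<lambda>x. (w - z) / ((z - complex_of_real x)\<^sup>2 * (w - complex_of_real x)))"
    have mk: "k \<in> borel_measurable borel"
      unfolding k_def by measurable
    have k_le: "cmod (k x) \<le> cmod (w - z) * 2 / \<delta> ^ 3" if "x \<in> \<Gamma>" for x
    proof -
      have "\<delta>\<^sup>2 * (\<delta> / 2) \<le> cmod (z - complex_of_real x) ^ 2 * cmod (w - complex_of_real x)"
        using away[OF that] away_w[OF that] \<delta> by (intro mult_mono power_mono) auto
      then have "cmod (w - z) / (cmod (z - complex_of_real x) ^ 2 * cmod (w - complex_of_real x))
          \<le> cmod (w - z) / (\<delta>\<^sup>2 * (\<delta> / 2))"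
        using \<delta> by (intro frac_le) auto
      then show ?thesis
        using \<delta> by (simp add: k_def norm_divide norm_mult norm_power power2_eq_square power3_eq_cube)
    qed
    have "complex_of_real (\<rho> x) * k x
        = (complex_of_real (\<rho> x) / (w - complex_of_real x)
            - complex_of_real (\<rho> x) / (z - complex_of_real x)) / (w - z)
          - complex_of_real (\<rho> x) * (- 1 / (z - complex_of_real x)\<^sup>2)"
      if "x \<in> \<Gamma>" for x
    proof -
      have "w - complex_of_real x \<noteq> 0" "z - complex_of_real x \<noteq> 0" "w - z \<noteq> 0"
        using away[OF that] away_w[OF that] \<delta> w(1) by auto
      moreover have "r * ((c - a) / (a\<^sup>2 * c)) = (r / c - r / a) / (c - a) - r * (- 1 / a\<^sup>2)"
        if "a \<noteq> 0" "c \<noteq> 0" "c - a \<noteq> 0" for r a c :: complex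
      proof -
        have "(r / c - r / a) / (c - a) = - r / (a * c)"
          using that by (simp add: diff_frac_eq nonzero_divide_eq_eq) (simp add: algebra_simps)
        then show ?thesis
          using that by (simp add: field_simps power2_eq_square)
      qed
      from this[of "z - complex_of_real x" "w - complex_of_real x" "complex_of_real (\<rho> x)"]
      have "z - complex_of_real x \<noteq> 0 \<Longrightarrow> w - complex_of_real x \<noteq> 0 \<Longrightarrow> w - z \<noteq> 0 \<Longrightarrow> ?thesis"
        unfolding k_def by simp
      ultimately show ?thesis by blast
    qed
    then have "(LINT x:\<Gamma>|lborel. complex_of_real (\<rho> x) * k x)
        = (LINT x:\<Gamma>|lborel. (complex_of_real (\<rho> x) / (w - complex_of_real x)
            - complex_of_real (\<rho> x) / (z - complex_of_real x)) / (w - z)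
          - complex_of_real (\<rho> x) * (- 1 / (z - complex_of_real x)\<^sup>2))"
      unfolding set_lebesgue_integral_def
      by (intro Bochner_Integration.integral_cong) (auto simp: indicator_def)
    also have "\<dots> = (stieltjes \<Gamma> \<rho> w - stieltjes \<Gamma> \<rho> z) / (w - z) - ?D"
      using set_integrable_stieltjes[OF \<rho> \<delta>2 away_w] set_integrable_stieltjes[OF \<rho> \<delta> away]
        set_integrable_mult_bounded_kernel[OF \<rho> m kz]
      unfolding stieltjes_def
      by (subst set_integral_diff(2))
         (auto intro!: set_integrable_divide set_integral_diff(1) simp: set_integral_diff(2))
    finally show ?thesis
      using norm_integral_mult_bounded_kernel_le[OF \<rho> mk k_le] by simp
  qed
  have "((\<lambda>w. cmod (w - z) * 2 / \<delta> ^ 3 * ?N) \<longlongrightarrow> cmod (z - z) * 2 / \<delta> ^ 3 * ?N) (at z)"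
    by (intro tendsto_intros) (use \<delta> in auto)
  then have lim: "((\<lambda>w. cmod (w - z) * 2 / \<delta> ^ 3 * ?N) \<longlongrightarrow> 0) (at z)"
    by simp
  have "\<forall>\<^sub>F w in at z. cmod ((stieltjes \<Gamma> \<rho> w - stieltjes \<Gamma> \<rho> z) / (w - z) - ?D)
      \<le> cmod (w - z) * 2 / \<delta> ^ 3 * ?N"
    unfolding eventually_at using bound \<delta> by (intro exI[of _ "\<delta> / 2"]) (auto simp: dist_norm)
  then have "((\<lambda>w. (stieltjes \<Gamma> \<rho> w - stieltjes \<Gamma> \<rho> z) / (w - z) - ?D) \<longlongrightarrow> 0) (at z)"
    by (rule Lim_null_comparison[OF _ lim])
  then show ?thesis
    unfolding has_field_derivative_iff using LIM_zero_iff by blast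
qed

lemma stieltjes_holomorphic_on:
  assumes "set_integrable lborel \<Gamma> \<rho>" "compact \<Gamma>"
  shows "stieltjes \<Gamma> \<rho> holomorphic_on - (complex_of_real ` \<Gamma>)"
  unfolding holomorphic_on_def field_differentiable_def
  using stieltjes_has_field_derivative[OF assms]
  by (meson ComplD has_field_derivative_at_within)

section \<open>A maximum principle with exceptional boundary points\<close>

text \<open>Polynomial growth at finitely many boundary points does not spoil the maximum principle. With
  \<open>u = (p - z) / (p - z\<^sub>0)\<close>, whose real part is nonnegative on the disc, the factor
  \<open>(u / (u + \<delta>)) ^ (N + 1)\<close> has modulus at most \<open>1\<close>, vanishes at \<open>p\<close> to an order that beats the growth
  of \<open>f\<close>, and tends to \<open>1\<close> as \<open>\<delta> \<longrightarrow> 0\<close>. The ordinary maximum principle applies to \<open>f\<close> times these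
  factors.\<close>

lemma phragmen_lindelof_disc:
  fixes f :: "complex \<Rightarrow> complex"
  assumes holf: "f holomorphic_on ball z0 d"
    and contf: "continuous_on (cball z0 d - P) f"
    and "0 < d" and P: "finite P" "P \<subseteq> sphere z0 d"
    and growth: "\<And>z. z \<in> cball z0 d - P \<Longrightarrow> cmod (f z) * (\<Prod>p\<in>P. cmod (p - z) ^ N) \<le> C"
    and bound: "\<And>z. z \<in> sphere z0 d - P \<Longrightarrow> cmod (f z) \<le> M"
    and "0 \<le> M" and z: "z \<in> ball z0 d"
  shows "cmod (f z) \<le> M"
proof -
  have re: "0 \<le> Re ((p - w) / (p - z0))" if "p \<in> P" "w \<in> cball z0 d" for p w
  proof -
    have p: "cmod (p - z0) = d"
      using that P by (auto simp: dist_norm norm_minus_commute)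
    then have "p - z0 \<noteq> 0" using \<open>0 < d\<close> by auto
    then have "(p - w) / (p - z0) = 1 - (w - z0) / (p - z0)"
      by (simp add: field_simps)
    moreover have "cmod ((w - z0) / (p - z0)) \<le> 1"
      using that(2) p \<open>0 < d\<close> by (simp add: norm_divide dist_norm norm_minus_commute)
    ultimately show ?thesis
      using complex_Re_le_cmod[of "(w - z0) / (p - z0)"] by simp
  qed
  define D where "D \<delta> p w = (p - w) / (p - z0) + complex_of_real \<delta>" for \<delta> p w
  define E where "E \<delta> w = (\<Prod>p\<in>P. ((p - w) / (p - z0) / D \<delta> p w) ^ Suc N)" for \<delta> w
  have D_ge: "cmod ((p - w) / (p - z0)) \<le> cmod (D \<delta> p w)" "\<delta> \<le> cmod (D \<delta> p w)"
    if "p \<in> P" "w \<in> cball z0 d" "0 < \<delta>" for p w \<delta>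
  proof -
    let ?u = "(p - w) / (p - z0)"
    have "0 \<le> Re ?u" using re that by blast
    then have "(Re ?u)\<^sup>2 \<le> (Re (D \<delta> p w))\<^sup>2" "\<delta> \<le> Re (D \<delta> p w)"
      using that(3) by (auto simp: D_def intro!: power_mono)
    moreover have "Im (D \<delta> p w) = Im ?u" by (simp add: D_def)
    ultimately show "cmod ?u \<le> cmod (D \<delta> p w)" "\<delta> \<le> cmod (D \<delta> p w)"
      using complex_Re_le_cmod[of "D \<delta> p w"] by (simp add: cmod_def, linarith)
  qed
  have h_le: "cmod (f z * E \<delta> z) \<le> M" if \<delta>: "0 < \<delta>" for \<delta>
  proof -
    have Dnz: "D \<delta> p w \<noteq> 0" if "p \<in> P" "w \<in> cball z0 d" for p w
      using D_ge(2)[OF that \<delta>] \<delta> by auto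
    have pnz: "p - z0 \<noteq> 0" if "p \<in> P" for p
      using that P \<open>0 < d\<close> by auto
    let ?h = "\<lambda>w. f w * E \<delta> w"
    have contE: "continuous_on (cball z0 d) (E \<delta>)"
      unfolding E_def D_def
      by (intro continuous_intros) (use Dnz pnz in \<open>auto simp: D_def\<close>)
    have "E \<delta> holomorphic_on ball z0 d"
      unfolding E_def D_def
      by (intro holomorphic_intros) (use Dnz pnz in \<open>auto simp: D_def\<close>)
    then have holh: "?h holomorphic_on ball z0 d"
      by (intro holomorphic_intros holf)
    have E0: "E \<delta> p = 0" if "p \<in> P" for p
      unfolding E_def using that P(1) by (auto simp: prod_zero_iff)
    define A where "A = (\<Prod>p\<in>P. (d * \<delta>) ^ Suc N)"
    have "0 < A"
      unfolding A_def using \<delta> \<open>0 < d\<close> by (intro prod_pos) auto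
    \<comment> \<open>Each exceptional point contributes \<open>N\<close> of its \<open>N + 1\<close> zeros to cancel the growth of \<open>f\<close>;
      the remaining one makes the product continuous with value \<open>0\<close> there.\<close>
    have decay: "cmod (?h w) \<le> C / A * (\<Prod>p\<in>P. cmod (p - w))" if w: "w \<in> cball z0 d - P" for w
    proof -
      have "cmod (E \<delta> w) = (\<Prod>p\<in>P. cmod ((p - w) / (p - z0) / D \<delta> p w) ^ Suc N)"
        unfolding E_def prod_norm[symmetric] norm_power ..
      also have "\<dots> \<le> (\<Prod>p\<in>P. (cmod (p - w) / (d * \<delta>)) ^ Suc N)"
      proof (intro prod_mono conjI zero_le_power norm_ge_zero power_mono)
        fix p assume p: "p \<in> P"
        then have "cmod (p - z0) = d" using P by (auto simp: dist_norm norm_minus_commute)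
        then show "cmod ((p - w) / (p - z0) / D \<delta> p w) \<le> cmod (p - w) / (d * \<delta>)"
          using D_ge(2)[OF p _ \<delta>, of w] w \<delta> \<open>0 < d\<close>
          by (auto simp: norm_divide norm_mult intro!: divide_left_mono mult_left_mono mult_pos_pos)
      qed
      also have "\<dots> = (\<Prod>p\<in>P. cmod (p - w) ^ N) * (\<Prod>p\<in>P. cmod (p - w)) / A"
        by (simp add: A_def power_divide prod_dividef prod.distrib mult.commute)
      finally have "cmod (?h w) \<le> cmod (f w) * ((\<Prod>p\<in>P. cmod (p - w) ^ N) * (\<Prod>p\<in>P. cmod (p - w)) / A)"
        unfolding norm_mult by (rule mult_left_mono) simp
      also have "\<dots> = (cmod (f w) * (\<Prod>p\<in>P. cmod (p - w) ^ N)) * ((\<Prod>p\<in>P. cmod (p - w)) / A)"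
        by simp
      also have "\<dots> \<le> C * ((\<Prod>p\<in>P. cmod (p - w)) / A)"
        using growth[OF w] \<open>0 < A\<close> by (intro mult_right_mono divide_nonneg_nonneg prod_nonneg) auto
      finally show ?thesis by simp
    qed
    have conth: "continuous_on (cball z0 d) ?h"
    proof (clarsimp simp only: continuous_on_eq_continuous_within)
      fix w assume w: "w \<in> cball z0 d"
      show "continuous (at w within cball z0 d) ?h"
      proof (cases "w \<in> P")
        case False
        have "open (- P)" using P(1) by (simp add: finite_imp_closed open_Compl)
        have "continuous_on (cball z0 d - P) ?h"
          by (intro continuous_intros contf continuous_on_subset[OF contE]) auto
        then have "continuous (at w within cball z0 d - P) ?h"
          using w False by (simp add: continuous_on_eq_continuous_within)
        moreover have "at w within cball z0 d = at w within (cball z0 d - P)"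
          using \<open>open (- P)\<close> False by (intro at_within_nhd[of _ "- P"]) auto
        ultimately show ?thesis by simp
      next
        case True
        have "((\<lambda>v. C / A * (\<Prod>p\<in>P. cmod (p - v))) \<longlongrightarrow> C / A * (\<Prod>p\<in>P. cmod (p - w)))
            (at w within cball z0 d)"
          by (intro tendsto_intros)
        moreover have "(\<Prod>p\<in>P. cmod (p - w)) = 0"
          using True P(1) by (auto simp: prod_zero_iff)
        ultimately have lim: "((\<lambda>v. C / A * (\<Prod>p\<in>P. cmod (p - v))) \<longlongrightarrow> 0) (at w within cball z0 d)"
          by simp
        have "open (- (P - {w}))"
          using P(1) by (simp only: open_Compl finite_imp_closed finite_Diff)
        then have "\<forall>\<^sub>F v in at w within cball z0 d.
            cmod (?h v) \<le> C / A * (\<Prod>p\<in>P. cmod (p - v))"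
          unfolding eventually_at_topological using decay
          by (intro exI[of _ "- (P - {w})"]) auto
        then have "(?h \<longlongrightarrow> 0) (at w within cball z0 d)"
          by (rule Lim_null_comparison[OF _ lim])
        then show ?thesis
          using E0[OF True] by (simp add: continuous_within)
      qed
    qed
    have "cmod (?h z) \<le> M"
    proof (rule maximum_modulus_frontier[of ?h "cball z0 d"])
      show "?h holomorphic_on interior (cball z0 d)" using holh by simp
      show "continuous_on (closure (cball z0 d)) ?h" using conth by simp
      show "bounded (cball z0 d)" by simp
      show "z \<in> cball z0 d" using z by auto
      fix w assume "w \<in> frontier (cball z0 d)"
      then have w: "w \<in> sphere z0 d" by simp
      show "cmod (?h w) \<le> M"
      proof (cases "w \<in> P")
        case True
        then show ?thesis using E0 \<open>0 \<le> M\<close> by simp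
      next
        case False
        have "cmod (E \<delta> w) \<le> 1"
          unfolding E_def prod_norm[symmetric]
        proof (intro prod_le_1 conjI norm_ge_zero)
          fix p assume p: "p \<in> P"
          have "cmod ((p - w) / (p - z0) / D \<delta> p w) \<le> 1"
            using D_ge(1)[OF p _ \<delta>, of w] w Dnz[OF p, of w] 
            by (subst norm_divide) (auto simp: divide_le_eq_1)
          then show "cmod (((p - w) / (p - z0) / D \<delta> p w) ^ Suc N) \<le> 1"
            unfolding norm_power by (intro power_le_one) auto
        qed
        then have "cmod (?h w) \<le> cmod (f w)"
          unfolding norm_mult by (intro mult_left_le) auto
        then show ?thesis using bound[of w] w False by auto
      qed
    qed
    then show ?thesis .
  qed
  have "z \<notin> P" using z P by auto
  have "((\<lambda>\<delta>. f z * E \<delta> z) \<longlongrightarrow> f z * E 0 z) (at_right 0)"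
  proof -
    have pz: "p - z0 \<noteq> 0" "p - z \<noteq> 0" if "p \<in> P" for p
      using that P \<open>0 < d\<close> \<open>z \<notin> P\<close> by auto
    show ?thesis
      unfolding E_def D_def by (intro tendsto_intros) (use pz in auto)
  qed
  moreover have "E 0 z = 1"
    unfolding E_def D_def using \<open>z \<notin> P\<close> P \<open>0 < d\<close> by (intro prod.neutral) auto
  ultimately have "((\<lambda>\<delta>. f z * E \<delta> z) \<longlongrightarrow> f z) (at_right 0)" by simp
  from tendsto_norm[OF this] show ?thesis
    by (rule tendsto_upperbound)
       (use h_le in \<open>auto simp: eventually_at_filter\<close>)
qed

section \<open>Boundary growth of the Stieltjes transform\<close>

text \<open>Coordinates are centred at the real part of the disc centre, which becomes \<open>b \<i>\<close>; the disc of
  radius \<open>d\<close> meets the real line in \<open>[-s, s]\<close>, the point \<open>v + y \<i>\<close> lies in the disc, and \<open>u\<close> is a real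
  point to the right of \<open>s\<close>. If \<open>v \<le> s\<close>, then \<open>u\<close> is no closer to \<open>v + y \<i>\<close> than \<open>s\<close> is. If \<open>v > s\<close>, the disc
  bulges over the real line beyond \<open>s\<close>, and its equation bounds the squared distance to \<open>s\<close> by
  \<open>2 d \<bar>y\<bar>\<close>. The square cannot be avoided: the disc may be tangent to the line.\<close>

lemma dist_to_exit_point_le:
  fixes s u v y b d :: real
  assumes "0 \<le> s" "s \<le> u" "v\<^sup>2 + y\<^sup>2 \<le> s\<^sup>2 + 2 * b * y" "\<bar>b\<bar> \<le> d"
    and diam: "(v - s)\<^sup>2 + y\<^sup>2 \<le> (2 * d)\<^sup>2"
  shows "(v - s)\<^sup>2 + y\<^sup>2 \<le> 2 * d * sqrt ((v - u)\<^sup>2 + y\<^sup>2)"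
proof (cases "v \<le> s")
  case True
  define q where "q = sqrt ((v - s)\<^sup>2 + y\<^sup>2)"
  have q2: "(v - s)\<^sup>2 + y\<^sup>2 = q * q"
    by (simp add: q_def)
  have "\<bar>v - s\<bar> \<le> \<bar>v - u\<bar>" using True assms(2) by simp
  then have "(v - s)\<^sup>2 \<le> (v - u)\<^sup>2" by (simp add: abs_le_square_iff)
  then have "q \<le> sqrt ((v - u)\<^sup>2 + y\<^sup>2)"
    by (simp add: q_def)
  moreover have "q \<le> 2 * d" "0 \<le> q"
    using diam assms(4) by (auto simp: q_def intro: real_le_lsqrt)
  ultimately show ?thesis
    unfolding q2 by (intro mult_mono) auto
next
  case False
  then have "(v - s) * (v - s) \<le> (v + s) * (v - s)"
    using assms(1) by (intro mult_right_mono) auto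
  then have "(v - s)\<^sup>2 + y\<^sup>2 \<le> 2 * (b * y)"
    using assms(3) by (simp add: power2_eq_square algebra_simps)
  also have "b * y \<le> d * \<bar>y\<bar>"
    using assms(4) abs_le_iff[of "b * y"] mult_right_mono[of "\<bar>b\<bar>" d "\<bar>y\<bar>"]
    by (simp add: abs_mult)
  also have "d * \<bar>y\<bar> \<le> d * sqrt ((v - u)\<^sup>2 + y\<^sup>2)"
    using assms(4) by (intro mult_left_mono real_le_rsqrt) auto
  finally show ?thesis by simp
qed

lemma finite_sphere_Int_Reals: "finite (sphere z0 d \<inter> \<real>)" for z0 :: complex
proof (rule finite_subset)
  let ?s = "sqrt (d\<^sup>2 - (Im z0)\<^sup>2)"
  show "sphere z0 d \<inter> \<real> \<subseteq> complex_of_real ` {Re z0 + ?s, Re z0 - ?s}"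
  proof
    fix p assume p: "p \<in> sphere z0 d \<inter> \<real>"
    then have im: "Im p = 0" by (simp add: complex_is_Real_iff)
    have "(cmod (z0 - p))\<^sup>2 = d\<^sup>2" using p by (simp add: dist_norm)
    then have sq: "(Re p - Re z0)\<^sup>2 = d\<^sup>2 - (Im z0)\<^sup>2"
      unfolding cmod_power2 by (simp add: im power2_commute algebra_simps)
    then have "\<bar>Re p - Re z0\<bar> = ?s"
      by (metis real_sqrt_abs)
    then have "Re p = Re z0 + ?s \<or> Re p = Re z0 - ?s" by linarith
    then show "p \<in> complex_of_real ` {Re z0 + ?s, Re z0 - ?s}"
      using im by (auto simp: complex_eq_iff image_iff)
  qed
qed simp

text \<open>With \<open>x\<close> ranging over the support, this bounds the singularities of a Cauchy kernel at the circle: for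
  each \<open>z\<close> and \<open>x\<close>, one of the points where the circle crosses the real line satisfies the bound of
  \<open>dist_to_exit_point_le\<close>, and the distances to the others are at most \<open>2 d\<close>. If the circle misses the
  real line, the product is empty and \<open>\<bar>z - x\<bar>\<close> is bounded below by the gap between disc and line.\<close>

lemma dist_real_outside_disc_bound:
  fixes z0 :: complex
  assumes "0 < d"
  obtains K where "0 < K"
    "\<And>z x. z \<in> cball z0 d \<Longrightarrow> d \<le> cmod (z0 - complex_of_real x) \<Longrightarrow>
      (\<Prod>p\<in>sphere z0 d \<inter> \<real>. cmod (p - z) ^ 2) \<le> K * cmod (z - complex_of_real x)"
proof (cases "\<bar>Im z0\<bar> \<le> d")
  case False
  have "sphere z0 d \<inter> \<real> = {}"
  proof -
    have False if "p \<in> sphere z0 d" "p \<in> \<real>" for p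
      using that False abs_Im_le_cmod[of "z0 - p"] by (auto simp: dist_norm complex_is_Real_iff)
    then show ?thesis by blast
  qed
  show ?thesis
  proof (rule that[of "1 / (\<bar>Im z0\<bar> - d)"])
    fix z x assume "z \<in> cball z0 d"
    then have "\<bar>Im z0\<bar> - d \<le> cmod (z - complex_of_real x)"
      using abs_Im_le_cmod[of "z0 - z"] abs_Im_le_cmod[of "z - complex_of_real x"]
      by (auto simp: dist_norm)
    then show "(\<Prod>p\<in>sphere z0 d \<inter> \<real>. cmod (p - z) ^ 2)
        \<le> 1 / (\<bar>Im z0\<bar> - d) * cmod (z - complex_of_real x)"
      using False by (simp add: \<open>sphere z0 d \<inter> \<real> = {}\<close> divide_simps)
  qed (use False in simp)
next
  case True
  let ?P = "sphere z0 d \<inter> \<real>"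
  define s where "s = sqrt (d\<^sup>2 - (Im z0)\<^sup>2)"
  have "(Im z0)\<^sup>2 \<le> d\<^sup>2"
    using True by (simp add: abs_le_square_iff[symmetric])
  then have s: "0 \<le> s" "s\<^sup>2 = d\<^sup>2 - (Im z0)\<^sup>2"
    by (auto simp: s_def)
  have exit: "complex_of_real (Re z0 + t) \<in> ?P" if "t\<^sup>2 = s\<^sup>2" for t
  proof -
    have "(cmod (z0 - complex_of_real (Re z0 + t)))\<^sup>2 = d\<^sup>2"
      unfolding cmod_power2 using s(2) that by simp
    then show ?thesis
      using \<open>0 < d\<close> by (auto simp: dist_norm power2_eq_iff_nonneg)
  qed
  have near: "\<exists>p\<in>?P. cmod (p - z) ^ 2 \<le> 2 * d * cmod (z - complex_of_real x)"
    if z: "z \<in> cball z0 d" and x: "d \<le> cmod (z0 - complex_of_real x)" for z x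
  proof -
    define v y u where "v = Re z - Re z0" and "y = Im z" and "u = x - Re z0"
    have "(cmod (z0 - z))\<^sup>2 \<le> d\<^sup>2"
      using z by (auto simp: dist_norm intro: power_mono)
    then have disc: "v\<^sup>2 + y\<^sup>2 \<le> s\<^sup>2 + 2 * Im z0 * y"
      unfolding cmod_power2 s(2) v_def y_def by (simp add: power2_eq_square algebra_simps)
    have "d\<^sup>2 \<le> (cmod (z0 - complex_of_real x))\<^sup>2"
      using x \<open>0 < d\<close> by (intro power_mono) auto
    then have "s\<^sup>2 \<le> u\<^sup>2"
      unfolding cmod_power2 s(2) u_def by (simp add: power2_commute)
    then have "s \<le> \<bar>u\<bar>"
      using s(1) by (simp add: abs_le_square_iff[symmetric])
    have dx: "cmod (z - complex_of_real x) = sqrt ((v - u)\<^sup>2 + y\<^sup>2)"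
      by (simp add: cmod_def v_def u_def y_def)
    have dp: "cmod (complex_of_real (Re z0 + t) - z) ^ 2 = (v - t)\<^sup>2 + y\<^sup>2" for t
      unfolding cmod_power2 by (simp add: v_def y_def power2_eq_square algebra_simps)
    have diam: "(v - t)\<^sup>2 + y\<^sup>2 \<le> (2 * d)\<^sup>2" if "t\<^sup>2 = s\<^sup>2" for t
    proof -
      have "cmod (complex_of_real (Re z0 + t) - z) \<le> 2 * d"
        using z exit[OF that] dist_triangle[of "complex_of_real (Re z0 + t)" z z0]
        by (auto simp: dist_norm norm_minus_commute)
      then show ?thesis
        unfolding dp[symmetric] by (intro power_mono) auto
    qed
    consider "s \<le> u" | "s \<le> - u" using \<open>s \<le> \<bar>u\<bar>\<close> by linarith
    then show ?thesis
    proof cases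
      case 1
      have "(v - s)\<^sup>2 + y\<^sup>2 \<le> 2 * d * sqrt ((v - u)\<^sup>2 + y\<^sup>2)"
        by (rule dist_to_exit_point_le[OF s(1) 1 disc True diam]) simp
      then show ?thesis
        using exit[of s] unfolding dx dp[symmetric] by blast
    next
      case 2
      have "(- v - s)\<^sup>2 + y\<^sup>2 \<le> 2 * d * sqrt ((- v - - u)\<^sup>2 + y\<^sup>2)"
        by (rule dist_to_exit_point_le[OF s(1) 2 _ True])
           (use disc diam[of "- s"] in \<open>auto simp: power2_eq_square algebra_simps\<close>)
      then have "(v - - s)\<^sup>2 + y\<^sup>2 \<le> 2 * d * sqrt ((v - u)\<^sup>2 + y\<^sup>2)"
        by (simp add: power2_eq_square algebra_simps)
      then show ?thesis
        using exit[of "- s"] unfolding dx dp[symmetric] by (metis power2_minus)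
    qed
  qed
  show ?thesis
  proof (rule that[of "2 * d * ((2 * d)\<^sup>2) ^ (card ?P - 1)"])
    fix z x assume z: "z \<in> cball z0 d" and x: "d \<le> cmod (z0 - complex_of_real x)"
    obtain p where p: "p \<in> ?P" "cmod (p - z) ^ 2 \<le> 2 * d * cmod (z - complex_of_real x)"
      using near[OF z x] by blast
    have "(\<Prod>p\<in>?P. cmod (p - z) ^ 2) = cmod (p - z) ^ 2 * (\<Prod>p\<in>?P - {p}. cmod (p - z) ^ 2)"
      by (rule prod.remove[OF finite_sphere_Int_Reals p(1)])
    also have "\<dots> \<le> (2 * d * cmod (z - complex_of_real x)) * (\<Prod>p\<in>?P - {p}. (2 * d)\<^sup>2)"
    proof (intro mult_mono p(2) prod_mono conjI zero_le_power2 prod_nonneg power_mono norm_ge_zero)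
      fix q assume "q \<in> ?P - {p}"
      then show "cmod (q - z) \<le> 2 * d"
        using z dist_triangle[of q z z0] by (auto simp: dist_norm norm_minus_commute)
    qed (use \<open>0 < d\<close> in auto)
    also have "(\<Prod>p\<in>?P - {p}. (2 * d)\<^sup>2) = ((2 * d)\<^sup>2) ^ (card ?P - 1)"
      using p(1) by (simp add: finite_sphere_Int_Reals)
    finally show "(\<Prod>p\<in>?P. cmod (p - z) ^ 2)
        \<le> 2 * d * ((2 * d)\<^sup>2) ^ (card ?P - 1) * cmod (z - complex_of_real x)"
      by (simp add: mult_ac)
  qed (use \<open>0 < d\<close> in simp)
qed

text \<open>All real points of the circle are treated as exceptional, since off them the
  circle avoids \<open>\<Gamma>\<close> and the hypothesis on \<open>M\<close> applies.\<close>

lemma stieltjes_le_circle_max: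
  assumes \<rho>: "set_integrable lborel \<Gamma> \<rho>" and \<Gamma>: "compact \<Gamma>"
    and "0 < d" and disc: "ball z0 d \<subseteq> - (complex_of_real ` \<Gamma>)"
    and M: "is_circle_max \<Gamma> (\<lambda>w. stieltjes \<Gamma> \<rho> w - \<zeta>) z0 d M"
    and z: "z \<in> ball z0 d"
  shows "cmod (stieltjes \<Gamma> \<rho> z - \<zeta>) \<le> M"
proof -
  let ?P = "sphere z0 d \<inter> \<real>"
  let ?Q = "\<lambda>z. \<Prod>p\<in>?P. cmod (p - z) ^ 2"
  have far: "d \<le> cmod (z0 - complex_of_real x)" if "x \<in> \<Gamma>" for x
    using disc that by (auto simp: dist_norm subset_iff not_less)
  obtain K where K: "0 < K"
    "\<And>z x. z \<in> cball z0 d \<Longrightarrow> d \<le> cmod (z0 - complex_of_real x) \<Longrightarrow>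
      ?Q z \<le> K * cmod (z - complex_of_real x)"
    using dist_real_outside_disc_bound[OF \<open>0 < d\<close>, of z0] by blast
  have off: "cball z0 d - ?P \<subseteq> - (complex_of_real ` \<Gamma>)"
  proof
    fix w assume w: "w \<in> cball z0 d - ?P"
    show "w \<in> - (complex_of_real ` \<Gamma>)"
    proof (cases "w \<in> ball z0 d")
      case False
      then have "w \<notin> \<real>" using w by auto
      then show ?thesis by (auto simp: Reals_def)
    qed (use disc in blast)
  qed
  have hol: "(\<lambda>w. stieltjes \<Gamma> \<rho> w - \<zeta>) holomorphic_on - (complex_of_real ` \<Gamma>)"
    by (intro holomorphic_intros stieltjes_holomorphic_on \<rho> \<Gamma>)
  show ?thesis
  proof (rule phragmen_lindelof_disc[where P = ?P and N = 2 and f = "\<lambda>w. stieltjes \<Gamma> \<rho> w - \<zeta>"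
        and C = "K * L1_norm_on \<Gamma> \<rho> + cmod \<zeta> * (\<Prod>p\<in>?P. (2 * d)\<^sup>2)"])
    show "(\<lambda>w. stieltjes \<Gamma> \<rho> w - \<zeta>) holomorphic_on ball z0 d"
      using hol disc by (rule holomorphic_on_subset)
    show "continuous_on (cball z0 d - ?P) (\<lambda>w. stieltjes \<Gamma> \<rho> w - \<zeta>)"
      using holomorphic_on_subset[OF hol off] by (rule holomorphic_on_imp_continuous_on)
    show "cmod (stieltjes \<Gamma> \<rho> w - \<zeta>) \<le> M" if "w \<in> sphere z0 d - ?P" for w
      using M that off sphere_cball[of z0 d] unfolding is_circle_max_def by blast
    show "0 \<le> M"
      using M unfolding is_circle_max_def by (metis norm_ge_zero)
    fix w assume w: "w \<in> cball z0 d - ?P"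
    have Q: "0 < ?Q w"
      using w by (intro prod_pos) auto
    \<comment> \<open>The product of squared distances, up to the factor \<open>K\<close>, is a lower bound for the distance
      of \<open>w\<close> to \<open>\<Gamma>\<close>.\<close>
    have "cmod (stieltjes \<Gamma> \<rho> w) \<le> 1 / (?Q w / K) * L1_norm_on \<Gamma> \<rho>"
    proof (rule norm_stieltjes_le[OF \<rho>])
      show "?Q w / K \<le> cmod (w - complex_of_real x)" if "x \<in> \<Gamma>" for x
        using K(2)[of w x] w far[OF that] K(1) by (simp add: divide_simps mult.commute)
    qed (use Q K(1) in auto)
    then have "cmod (stieltjes \<Gamma> \<rho> w) * ?Q w \<le> K * L1_norm_on \<Gamma> \<rho>"
      using Q by (simp add: field_simps)
    moreover have "?Q w \<le> (\<Prod>p\<in>?P. (2 * d)\<^sup>2)"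
    proof (intro prod_mono conjI zero_le_power2 power_mono norm_ge_zero)
      fix p assume "p \<in> ?P"
      then show "cmod (p - w) \<le> 2 * d"
        using w dist_triangle[of p w z0] by (auto simp: dist_norm norm_minus_commute)
    qed
    then have "cmod \<zeta> * ?Q w \<le> cmod \<zeta> * (\<Prod>p\<in>?P. (2 * d)\<^sup>2)"
      by (rule mult_left_mono) simp
    moreover have "cmod (stieltjes \<Gamma> \<rho> w - \<zeta>) * ?Q w \<le> (cmod (stieltjes \<Gamma> \<rho> w) + cmod \<zeta>) * ?Q w"
      using Q by (intro mult_right_mono norm_triangle_ineq4) auto
    ultimately show "cmod (stieltjes \<Gamma> \<rho> w - \<zeta>) * ?Q w
        \<le> K * L1_norm_on \<Gamma> \<rho> + cmod \<zeta> * (\<Prod>p\<in>?P. (2 * d)\<^sup>2)"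
      by (simp add: distrib_right)
  qed (use \<open>0 < d\<close> z finite_sphere_Int_Reals in auto)
qed

section \<open>Taylor remainders and the order of a zero\<close>

text \<open>A bound in the open disc gives the Cauchy estimate with the full radius \<open>d\<close>, as the limit of the
  estimates on smaller circles.\<close>

lemma Cauchy_inequality_ball:
  assumes holf: "f holomorphic_on ball z0 d" and "0 < d"
    and M: "\<And>z. z \<in> ball z0 d \<Longrightarrow> cmod (f z) \<le> M"
  shows "cmod ((deriv ^^ n) f z0) \<le> fact n * M / d ^ n"
proof (rule tendsto_lowerbound)
  show "((\<lambda>r. fact n * M / r ^ n) \<longlongrightarrow> fact n * M / d ^ n) (at_left d)"
    by (intro tendsto_intros) (use \<open>0 < d\<close> in auto)
  have "\<forall>\<^sub>F r in at_left d. 0 < r \<and> r < d"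
    using \<open>0 < d\<close> by (auto simp: eventually_at_left_field intro: exI[of _ 0])
  then show "\<forall>\<^sub>F r in at_left d. cmod ((deriv ^^ n) f z0) \<le> fact n * M / r ^ n"
  proof eventually_elim
    case (elim r)
    then have sub: "cball z0 r \<subseteq> ball z0 d" "ball z0 r \<subseteq> ball z0 d" by auto
    show ?case
    proof (rule Cauchy_inequality)
      show "f holomorphic_on ball z0 r" using holf sub(2) by (rule holomorphic_on_subset)
      show "continuous_on (cball z0 r) f"
        using holomorphic_on_subset[OF holf sub(1)] by (rule holomorphic_on_imp_continuous_on)
      show "cmod (f x) \<le> M" if "cmod (z0 - x) = r" for x
        using M[of x] that elim by (simp add: dist_norm)
    qed (use elim in simp)
  qed
qed simp

text \<open>The remainder is dominated term by term by the geometric series \<open>\<Sum>n\<ge>k. M b\<^sup>n\<close>.\<close>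

lemma Taylor_remainder_le:
  assumes holf: "f holomorphic_on ball z0 d" and "0 < d"
    and M: "\<And>z. z \<in> ball z0 d \<Longrightarrow> cmod (f z) \<le> M"
    and z: "z \<in> ball z0 d" and b: "b = cmod (z - z0) / d"
  shows "cmod (f z - (\<Sum>n<k. (deriv ^^ n) f z0 / fact n * (z - z0) ^ n)) \<le> M * (b ^ k / (1 - b))"
proof -
  define a where "a n = (deriv ^^ n) f z0 / fact n * (z - z0) ^ n" for n
  have b01: "0 \<le> b" "b < 1"
    using z \<open>0 < d\<close> by (auto simp: b dist_norm norm_minus_commute)
  have a_le: "cmod (a n) \<le> M * b ^ n" for n
  proof -
    have "cmod (a n) = cmod ((deriv ^^ n) f z0) / fact n * cmod (z - z0) ^ n"
      by (simp add: a_def norm_mult norm_divide norm_power)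
    also have "\<dots> \<le> (fact n * M / d ^ n) / fact n * cmod (z - z0) ^ n"
      using Cauchy_inequality_ball[OF holf \<open>0 < d\<close> M]
      by (intro mult_right_mono divide_right_mono) auto
    also have "\<dots> = M * b ^ n"
      by (simp add: b power_divide)
    finally show ?thesis .
  qed
  have "a sums f z"
    unfolding a_def by (rule holomorphic_power_series[OF holf z])
  then have "(\<lambda>n. a (n + k)) sums (f z - (\<Sum>n<k. a n))"
    by (rule sums_split_initial_segment)
  moreover have "(\<lambda>n. M * b ^ k * b ^ n) sums (M * b ^ k * (1 / (1 - b)))"
    using b01 by (intro sums_mult geometric_sums) auto
  ultimately have "cmod (f z - (\<Sum>n<k. a n)) \<le> M * b ^ k * (1 / (1 - b))"
  proof (rule norm_sums_le)
    show "cmod (a (n + k)) \<le> M * b ^ k * b ^ n" for n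
      using a_le[of "n + k"] by (simp add: power_add mult_ac)
  qed
  then show ?thesis by (simp add: a_def)
qed

text \<open>The order of a zero is the index of the first nonvanishing derivative, and such an index exists by the
  identity theorem.\<close>

lemma higher_deriv_eq_0_below_zorder:
  assumes holf: "f holomorphic_on S" and "open S" "connected S" "z \<in> S"
    and nz: "\<exists>w\<in>S. f w \<noteq> 0" and "zorder f z = int k" and "n < k"
  shows "(deriv ^^ n) f z = 0"
proof -
  obtain m where m: "(deriv ^^ m) f z \<noteq> 0"
    using holomorphic_fun_eq_0_on_connected[OF holf \<open>open S\<close> \<open>connected S\<close>, of z] assms(4) nz
    by blast
  define m0 where "m0 = (LEAST m. (deriv ^^ m) f z \<noteq> 0)"
  have "(deriv ^^ m0) f z \<noteq> 0" "\<And>i. i < m0 \<Longrightarrow> (deriv ^^ i) f z = 0"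
    unfolding m0_def using LeastI[of "\<lambda>m. (deriv ^^ m) f z \<noteq> 0", OF m] not_less_Least by blast+
  then have "zorder f z = int m0"
    by (intro zorder_zero_eqI[OF holf \<open>open S\<close> \<open>z \<in> S\<close>]) auto
  then show ?thesis
    using assms(6,7) \<open>\<And>i. i < m0 \<Longrightarrow> (deriv ^^ i) f z = 0\<close> by simp
qed

text \<open>Near \<open>z0\<close>, \<open>f\<close> is \<open>(w - z0)\<^sup>k\<close> times a holomorphic function without zeros; the constant \<open>c\<close> is the
  minimum modulus of that function.\<close>

lemma zorder_lower_bound:
  assumes holf: "f holomorphic_on S" and "open S" "connected S" "z0 \<in> S"
    and "f z0 = 0" and nz: "\<exists>w\<in>S. f w \<noteq> 0" and ord: "zorder f z0 = int k"
  obtains c r where "0 < c" "0 < r" "cball z0 r \<subseteq> S" "0 < k"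
    "\<And>w. w \<in> cball z0 r \<Longrightarrow> c * cmod (w - z0) ^ k \<le> cmod (f w)"
proof -
  obtain r where k: "0 < k" and r: "0 < r" "cball z0 r \<subseteq> S"
    and hol: "zor_poly f z0 holomorphic_on cball z0 r"
    and eq: "\<And>w. w \<in> cball z0 r \<Longrightarrow>
      f w = zor_poly f z0 w * (w - z0) ^ k \<and> zor_poly f z0 w \<noteq> 0"
    using zorder_exist_zero[OF holf \<open>open S\<close> \<open>connected S\<close> \<open>z0 \<in> S\<close> nz] \<open>f z0 = 0\<close> ord by auto
  have "continuous_on (cball z0 r) (\<lambda>w. cmod (zor_poly f z0 w))"
    using hol by (intro continuous_on_norm holomorphic_on_imp_continuous_on)
  then obtain w0 where w0: "w0 \<in> cball z0 r"
    "\<And>w. w \<in> cball z0 r \<Longrightarrow> cmod (zor_poly f z0 w0) \<le> cmod (zor_poly f z0 w)"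
    using continuous_attains_inf[of "cball z0 r" "\<lambda>w. cmod (zor_poly f z0 w)"] r by fastforce
  show ?thesis
  proof (rule that[OF _ r k])
    show "0 < cmod (zor_poly f z0 w0)" using eq[OF w0(1)] by simp
    fix w assume w: "w \<in> cball z0 r"
    have "cmod (f w) = cmod (zor_poly f z0 w) * cmod (w - z0) ^ k"
      using eq[OF w] by (simp add: norm_mult norm_power)
    then show "cmod (zor_poly f z0 w0) * cmod (w - z0) ^ k \<le> cmod (f w)"
      using w0(2)[OF w] by (simp add: mult_right_mono)
  qed
qed

section \<open>Zero counts under perturbation\<close>

lemma finite_zeros_in_smaller_disc:
  assumes "f holomorphic_on ball z0 d" "r < d" "w \<in> ball z0 d" "f w \<noteq> 0"
  shows "finite {z \<in> cball z0 r. f z = 0}"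
proof (cases "f constant_on ball z0 d")
  case True
  then obtain c where c: "\<And>z. z \<in> ball z0 d \<Longrightarrow> f z = c"
    unfolding constant_on_def by blast
  have "{z \<in> cball z0 r. f z = 0} = {}"
    using c assms by force
  then show ?thesis by (metis finite.emptyI)
next
  case False
  show ?thesis
    by (rule holomorphic_compact_finite_zeros[OF assms(1) _ _ _ _ False]) (use assms in auto)
qed

text \<open>The argument principle on a circle: the theorem of Rouche counts with winding numbers, which are \<open>1\<close>
  inside the circle and \<open>0\<close> outside, and no zeros lie on it. It is applied on an intermediate disc of
  radius \<open>R\<close>, because the number of zeros in the whole domain may be infinite.\<close>

lemma Rouche_disc:
  assumes f: "f holomorphic_on ball z0 d" and g: "g holomorphic_on ball z0 d"
    and r: "0 < r" "r < d"
    and less: "\<And>z. z \<in> sphere z0 r \<Longrightarrow> cmod (g z) < cmod (f z)"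
  shows "finite {z \<in> ball z0 r. f z + g z = 0}"
    and "(\<Sum>z\<in>{z \<in> ball z0 r. f z + g z = 0}. zorder (\<lambda>z. f z + g z) z)
       = (\<Sum>z\<in>{z \<in> ball z0 r. f z = 0}. zorder f z)"
proof -
  define R where "R = (r + d) / 2"
  have R: "r < R" "R < d" using r by (auto simp: R_def)
  let ?\<gamma> = "circlepath z0 r"
  have nz: "f z \<noteq> 0" "f z + g z \<noteq> 0" if "z \<in> sphere z0 r" for z
    using less[OF that] by (auto simp: add_eq_0_iff)
  obtain w where w: "w \<in> sphere z0 r"
    using vector_choose_dist[of r z0] r(1) by (auto simp: sphere_def)
  then have wd: "w \<in> ball z0 d" using r by auto
  have fg: "(\<lambda>z. f z + g z) holomorphic_on ball z0 d"
    by (intro holomorphic_intros f g)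
  have fin_cb: "finite {z \<in> cball z0 R. f z + g z = 0}" "finite {z \<in> cball z0 R. f z = 0}"
    using finite_zeros_in_smaller_disc[OF fg R(2) wd nz(2)[OF w]]
      finite_zeros_in_smaller_disc[OF f R(2) wd nz(1)[OF w]] .
  have fin: "finite {z \<in> ball z0 R. f z + g z = 0}" "finite {z \<in> ball z0 R. f z = 0}"
    by (rule finite_subset[OF _ fin_cb(1)], auto) (rule finite_subset[OF _ fin_cb(2)], auto)
  then show "finite {z \<in> ball z0 r. f z + g z = 0}"
    by (rule_tac finite_subset[rotated]) (use R in auto)
  have RouR: "(\<Sum>p\<in>{z \<in> ball z0 R. f z + g z = 0}. winding_number ?\<gamma> p * zorder (\<lambda>p. f p + g p) p)
       = (\<Sum>p\<in>{z \<in> ball z0 R. f z = 0}. winding_number ?\<gamma> p * zorder f p)"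
  proof (rule Rouche_theorem)
    show "f holomorphic_on ball z0 R" "g holomorphic_on ball z0 R"
      using R by (auto intro!: holomorphic_on_subset[OF f] holomorphic_on_subset[OF g])
    show "path_image ?\<gamma> \<subseteq> ball z0 R" using r R by auto
    show "\<forall>z\<in>path_image ?\<gamma>. cmod (g z) < cmod (f z)" using less r by simp
    show "\<forall>z. z \<notin> ball z0 R \<longrightarrow> winding_number ?\<gamma> z = 0"
      using r R by (intro allI impI winding_number_zero_outside[where s = "cball z0 r"]) auto
  qed (use fin in auto)
  \<comment> \<open>Zeros between the two radii have winding number \<open>0\<close>, those inside have winding number \<open>1\<close>.\<close>
  have collapse: "(\<Sum>p\<in>{z \<in> ball z0 R. h z = 0}. winding_number ?\<gamma> p * zorder h p)
      = of_int (\<Sum>p\<in>{z \<in> ball z0 r. h z = 0}. zorder h p)"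
    if "finite {z \<in> ball z0 R. h z = 0}" and hnz: "\<And>z. z \<in> sphere z0 r \<Longrightarrow> h z \<noteq> 0"
    for h :: "complex \<Rightarrow> complex"
  proof -
    have "(\<Sum>p\<in>{z \<in> ball z0 R. h z = 0}. winding_number ?\<gamma> p * zorder h p)
        = (\<Sum>p\<in>{z \<in> ball z0 r. h z = 0}. winding_number ?\<gamma> p * zorder h p)"
    proof (rule sum.mono_neutral_right)
      show "\<forall>p\<in>{z \<in> ball z0 R. h z = 0} - {z \<in> ball z0 r. h z = 0}.
          winding_number ?\<gamma> p * zorder h p = 0"
      proof
        fix p assume p: "p \<in> {z \<in> ball z0 R. h z = 0} - {z \<in> ball z0 r. h z = 0}"
        then have "p \<notin> cball z0 r" using hnz[of p] by auto
        then have "winding_number ?\<gamma> p = 0"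
          using r by (intro winding_number_zero_outside[where s = "cball z0 r"]) auto
        then show "winding_number ?\<gamma> p * zorder h p = 0" by simp
      qed
    qed (use that R in auto)
    also have "\<dots> = (\<Sum>p\<in>{z \<in> ball z0 r. h z = 0}. of_int (zorder h p))"
      by (intro sum.cong refl) (auto simp: winding_number_circlepath dist_norm norm_minus_commute)
    finally show ?thesis by simp
  qed
  show "(\<Sum>z\<in>{z \<in> ball z0 r. f z + g z = 0}. zorder (\<lambda>z. f z + g z) z)
       = (\<Sum>z\<in>{z \<in> ball z0 r. f z = 0}. zorder f z)"
    using RouR collapse[OF fin(1) nz(2)] collapse[OF fin(2) nz(1)] by (simp only: of_int_eq_iff)
qed

lemma has_zero_count_perturbation:
  assumes "f holomorphic_on ball z0 d" "F holomorphic_on ball z0 d" "0 < r" "r < d"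
    and zero: "f z0 = 0" and only: "\<And>z. z \<in> ball z0 d \<Longrightarrow> f z = 0 \<Longrightarrow> z = z0"
    and ord: "zorder f z0 = int k"
    and less: "\<And>z. z \<in> sphere z0 r \<Longrightarrow> cmod (F z - f z) < cmod (f z)"
  shows "has_zero_count F (ball z0 r) k"
proof -
  have g: "(\<lambda>z. F z - f z) holomorphic_on ball z0 d"
    by (intro holomorphic_intros assms)
  have "{z \<in> ball z0 r. f z = 0} = {z0}"
    using zero only assms(3,4) by (auto intro: only)
  then show ?thesis
    using Rouche_disc[OF assms(1) g assms(3,4) less] ord by (simp add: has_zero_count_def)
qed

section \<open>Stability of the roots\<close>

lemma le_powr_inverse_of_power_le:
  fixes a b :: real
  assumes "0 \<le> a" "0 < k" "a ^ k \<le> b"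
  shows "a \<le> b powr (1 / real k)"
proof (cases "a = 0")
  case False
  then have "0 < a" using assms(1) by simp
  have "a = (a powr real k) powr (1 / real k)"
    using \<open>0 < a\<close> assms(2) by (simp add: powr_powr)
  also have "\<dots> = (a ^ k) powr (1 / real k)"
    using \<open>0 < a\<close> by (simp add: powr_realpow)
  also have "\<dots> \<le> b powr (1 / real k)"
    using assms by (intro powr_mono2) auto
  finally show ?thesis .
qed simp

theorem theorem5p6:
  fixes \<mu> :: "real measure" and \<mu>m :: "nat \<Rightarrow> real measure"
    and \<Gamma> :: "real set"
    and \<rho> :: "real \<Rightarrow> real" and \<rho>m :: "nat \<Rightarrow> real \<Rightarrow> real"
    and \<zeta> z0 :: complex and d :: real and k :: nat
  assumes "compact \<Gamma>"
    and "measure_support \<mu> = \<Gamma>" and "\<And>m. measure_support (\<mu>m m) = \<Gamma>"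
    and "has_density_on \<mu> \<Gamma> \<rho>" and "\<And>m. has_density_on (\<mu>m m) \<Gamma> (\<rho>m m)"
    and "(\<lambda>m. L1_norm_on \<Gamma> (\<lambda>x. \<rho>m m x - \<rho> x)) \<longlonglongrightarrow> 0"
    and "d > 0" and "ball z0 d \<subseteq> - (complex_of_real ` \<Gamma>)"
    and "stieltjes \<Gamma> \<rho> z0 = \<zeta>"
    and "\<And>z. z \<in> ball z0 d \<Longrightarrow> stieltjes \<Gamma> \<rho> z = \<zeta> \<Longrightarrow> z = z0"
    and "zorder (\<lambda>z. stieltjes \<Gamma> \<rho> z - \<zeta>) z0 = int k"
  shows "(\<forall>M \<epsilon> b m.
            is_circle_max \<Gamma> (\<lambda>w. stieltjes \<Gamma> \<rho> w - \<zeta>) z0 d M \<longrightarrow>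
            0 < \<epsilon> \<longrightarrow> \<epsilon> < d \<longrightarrow> b = \<epsilon> / d \<longrightarrow>
            1 / (infdist z0 (complex_of_real ` \<Gamma>) - \<epsilon>) * L1_norm_on \<Gamma> (\<lambda>x. \<rho>m m x - \<rho> x)
              < cmod ((deriv ^^ k) (stieltjes \<Gamma> \<rho>) z0) / fact k * \<epsilon> ^ k
                - M * (b ^ (k + 1) / (1 - b)) \<longrightarrow>
            has_zero_count (\<lambda>z. stieltjes \<Gamma> (\<rho>m m) z - \<zeta>) (ball z0 \<epsilon>) k)
         \<and>
         (\<exists>C. \<forall>r. 0 < r \<longrightarrow> r < d \<longrightarrow>
            (\<forall>\<^sub>F m in sequentially.
               has_zero_count (\<lambda>z. stieltjes \<Gamma> (\<rho>m m) z - \<zeta>) (ball z0 r) k \<and>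
               (\<forall>w \<in> ball z0 r. stieltjes \<Gamma> (\<rho>m m) w = \<zeta> \<longrightarrow>
                  dist w z0 \<le> C * L1_norm_on \<Gamma> (\<lambda>x. \<rho>m m x - \<rho> x) powr (1 / real k))))"
proof -
  define f where "f = (\<lambda>z. stieltjes \<Gamma> \<rho> z - \<zeta>)"
  define F where "F m = (\<lambda>z. stieltjes \<Gamma> (\<rho>m m) z - \<zeta>)" for m
  define D where "D = infdist z0 (complex_of_real ` \<Gamma>)"
  define L where "L m = L1_norm_on \<Gamma> (\<lambda>x. \<rho>m m x - \<rho> x)" for m
  have int: "set_integrable lborel \<Gamma> \<rho>" "\<And>m. set_integrable lborel \<Gamma> (\<rho>m m)"
    using assms(4,5) by (auto simp: has_density_on_def)
  have hol: "f holomorphic_on ball z0 d" "\<And>m. F m holomorphic_on ball z0 d"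
    unfolding f_def F_def
    by (intro holomorphic_intros holomorphic_on_subset[OF stieltjes_holomorphic_on assms(8)] int
        \<open>compact \<Gamma>\<close>)+
  have holG: "stieltjes \<Gamma> \<rho> holomorphic_on ball z0 d"
    by (intro holomorphic_on_subset[OF stieltjes_holomorphic_on assms(8)] int \<open>compact \<Gamma>\<close>)
  have f0: "f z0 = 0" and only: "\<And>z. z \<in> ball z0 d \<Longrightarrow> f z = 0 \<Longrightarrow> z = z0"
    and ord: "zorder f z0 = int k"
    using assms(9-11) by (auto simp: f_def)
  have nz: "\<exists>w\<in>ball z0 d. f w \<noteq> 0"
  proof -
    have "z0 + complex_of_real (d / 2) \<in> ball z0 d" "z0 + complex_of_real (d / 2) \<noteq> z0"
      using \<open>d > 0\<close> by (auto simp: dist_norm)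
    then show ?thesis using only by blast
  qed
  have z0: "z0 \<in> ball z0 d" using \<open>d > 0\<close> by simp
  \<comment> \<open>An empty support would make \<open>f\<close> constant. Nonemptiness matters because the infimum defining
    \<open>D\<close> is \<open>0\<close> by convention for the empty set.\<close>
  have "\<Gamma> \<noteq> {}"
    using nz f0 by (auto simp: f_def stieltjes_def set_lebesgue_integral_def)
  then have dD: "d \<le> D"
    unfolding D_def infdist_def using assms(8)
    by (auto intro!: cINF_greatest simp: subset_iff not_less)
  have diff_le: "cmod (F m z - f z) \<le> 1 / (D - r) * L m" if "z \<in> cball z0 r" "r < d" for m z r
  proof -
    have "D - r \<le> cmod (z - complex_of_real x)" if "x \<in> \<Gamma>" for x
    proof -
      have "D \<le> dist z0 (complex_of_real x)"
        unfolding D_def using that by (intro infdist_le) auto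
      also have "\<dots> \<le> dist z0 z + dist z (complex_of_real x)" by (rule dist_triangle)
      finally show ?thesis using \<open>z \<in> cball z0 r\<close> by (simp add: dist_norm)
    qed
    then show ?thesis
      using norm_stieltjes_diff_le[OF int(1) int(2)[of m], of "D - r" z] that(2) dD
      by (simp add: F_def f_def L_def)
  qed
  obtain c r0 where c: "0 < c" and r0: "0 < r0" "cball z0 r0 \<subseteq> ball z0 d" and "0 < k"
    and lower: "\<And>w. w \<in> cball z0 r0 \<Longrightarrow> c * cmod (w - z0) ^ k \<le> cmod (f w)"
    using zorder_lower_bound[OF hol(1) open_ball connected_ball z0 f0 nz ord] by blast

  have count: "has_zero_count (F m) (ball z0 \<epsilon>) k"
    if M: "is_circle_max \<Gamma> f z0 d M" and \<epsilon>: "0 < \<epsilon>" "\<epsilon> < d" and b: "b = \<epsilon> / d"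
      and small: "1 / (D - \<epsilon>) * L m
        < cmod ((deriv ^^ k) (stieltjes \<Gamma> \<rho>) z0) / fact k * \<epsilon> ^ k - M * (b ^ (k + 1) / (1 - b))"
    for M \<epsilon> b m
  proof (rule has_zero_count_perturbation[OF hol(1) hol(2) \<epsilon> f0 only ord])
    fix z assume z: "z \<in> sphere z0 \<epsilon>"
    then have zd: "z \<in> ball z0 d" and nrm: "cmod (z - z0) = \<epsilon>"
      using \<epsilon> by (auto simp: dist_norm norm_minus_commute)
    have Mle: "cmod (f w) \<le> M" if "w \<in> ball z0 d" for w
      using stieltjes_le_circle_max[OF int(1) assms(1,7,8), of \<zeta> M w] M that by (simp add: f_def)
    have low: "(deriv ^^ n) f z0 = 0" if "n < k" for n
      by (rule higher_deriv_eq_0_below_zorder[OF hol(1) _ _ z0 nz ord that]) auto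
    \<comment> \<open>The constant \<open>\<zeta>\<close> drops out because \<open>k > 0\<close>.\<close>
    have "(deriv ^^ k) f z0 = (deriv ^^ k) (stieltjes \<Gamma> \<rho>) z0"
      using higher_deriv_diff[OF holG, of "\<lambda>_. \<zeta>" z0 k] z0 \<open>0 < k\<close>
      by (simp add: f_def)
    then have "(\<Sum>n<k + 1. (deriv ^^ n) f z0 / fact n * (z - z0) ^ n)
        = (deriv ^^ k) (stieltjes \<Gamma> \<rho>) z0 / fact k * (z - z0) ^ k"
      using low by simp
    then have "cmod (f z - (deriv ^^ k) (stieltjes \<Gamma> \<rho>) z0 / fact k * (z - z0) ^ k)
        \<le> M * (b ^ (k + 1) / (1 - b))"
      using Taylor_remainder_le[OF hol(1) \<open>d > 0\<close> Mle zd, of b "k + 1"] b nrm by simp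
    moreover have "cmod ((deriv ^^ k) (stieltjes \<Gamma> \<rho>) z0 / fact k * (z - z0) ^ k)
        = cmod ((deriv ^^ k) (stieltjes \<Gamma> \<rho>) z0) / fact k * \<epsilon> ^ k"
      by (simp add: norm_mult norm_divide norm_power nrm)
    ultimately have "cmod ((deriv ^^ k) (stieltjes \<Gamma> \<rho>) z0) / fact k * \<epsilon> ^ k
        - M * (b ^ (k + 1) / (1 - b)) \<le> cmod (f z)"
      using norm_triangle_ineq2[of "(deriv ^^ k) (stieltjes \<Gamma> \<rho>) z0 / fact k * (z - z0) ^ k" "f z"]
      by (simp add: norm_minus_commute)
    then show "cmod (F m z - f z) < cmod (f z)"
      using diff_le[of z \<epsilon> m] z \<epsilon> small by auto
  qed

  have r0d: "r0 < d"
    using r0 by (simp add: cball_subset_ball_iff)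
  \<comment> \<open>A root \<open>w\<close> in the disc of radius \<open>r0\<close> satisfies \<open>c \<bar>w - z0\<bar>\<^sup>k \<le> L m / (D - r0)\<close>. This radius
    is fixed, so the constant does not depend on \<open>r\<close>.\<close>
  define C where "C = (1 / (c * (D - r0))) powr (1 / real k)"
  have asym: "\<forall>\<^sub>F m in sequentially. has_zero_count (F m) (ball z0 r) k \<and>
      (\<forall>w\<in>ball z0 r. stieltjes \<Gamma> (\<rho>m m) w = \<zeta> \<longrightarrow> dist w z0 \<le> C * L m powr (1 / real k))"
    if r: "0 < r" "r < d" for r
  proof -
    \<comment> \<open>On this compact set \<open>f\<close> has no zeros. It contains the circle of radius \<open>r\<close>, as the zero count
      requires, and the part of the disc where \<open>zorder_lower_bound\<close> says nothing.\<close>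
    define K where "K = cball z0 r - ball z0 (min r r0)"
    have "compact K"
      unfolding K_def by (intro compact_diff) auto
    have Kd: "K \<subseteq> ball z0 d" using r by (auto simp: K_def)
    have sphK: "sphere z0 r \<subseteq> K" by (auto simp: K_def)
    have "K \<noteq> {}" using sphK r by (metis sphere_eq_empty subset_empty not_less_iff_gr_or_eq)
    have "continuous_on K (\<lambda>z. cmod (f z))"
      using holomorphic_on_subset[OF hol(1) Kd]
      by (intro continuous_on_norm holomorphic_on_imp_continuous_on)
    then obtain w0 where w0: "w0 \<in> K" "\<And>w. w \<in> K \<Longrightarrow> cmod (f w0) \<le> cmod (f w)"
      using continuous_attains_inf[OF \<open>compact K\<close> \<open>K \<noteq> {}\<close>] by blast
    have "w0 \<noteq> z0" using w0(1) r r0 by (auto simp: K_def)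
    then have e: "0 < cmod (f w0)"
      using only[of w0] w0(1) Kd by auto
    have "(\<lambda>m. 1 / (D - r) * L m) \<longlonglongrightarrow> 0"
      using tendsto_mult_left[OF assms(6), of "1 / (D - r)"] by (simp add: L_def)
    then have "\<forall>\<^sub>F m in sequentially. 1 / (D - r) * L m < cmod (f w0)"
      using e by (rule order_tendstoD(2))
    then show ?thesis
    proof eventually_elim
      case (elim m)
      have less: "cmod (F m z - f z) < cmod (f z)" if "z \<in> K" for z
        using diff_le[of z r m] that r elim w0(2)[OF that] by (auto simp: K_def)
      have "dist w z0 \<le> C * L m powr (1 / real k)"
        if w: "w \<in> ball z0 r" and "stieltjes \<Gamma> (\<rho>m m) w = \<zeta>" for w
      proof -
        have Fw: "F m w = 0" using that by (simp add: F_def)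
        then have "w \<notin> K" using less[of w] by auto
        then have wr0: "w \<in> cball z0 r0" using w by (auto simp: K_def)
        have "c * cmod (w - z0) ^ k \<le> 1 / (D - r0) * L m"
          using lower[OF wr0] diff_le[OF wr0 r0d, of m] Fw by simp
        then have "cmod (w - z0) ^ k \<le> 1 / (c * (D - r0)) * L m"
          using c r0d dD by (simp add: field_simps)
        then have "cmod (w - z0) \<le> (1 / (c * (D - r0)) * L m) powr (1 / real k)"
          using \<open>0 < k\<close> by (intro le_powr_inverse_of_power_le) auto
        also have "\<dots> = C * L m powr (1 / real k)"
          unfolding C_def by (rule powr_mult)
        finally show ?thesis by (simp add: dist_norm)
      qed
      moreover have "has_zero_count (F m) (ball z0 r) k"
        using less sphK by (intro has_zero_count_perturbation[OF hol(1) hol(2) r f0 only ord]) auto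
      ultimately show ?case by blast
    qed
  qed
  show ?thesis
    using count asym unfolding f_def F_def D_def L_def by blast
qed

end
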